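(* Let $G$ be a finite simple bipartite $2$-degenerate graph with maximum degree at most $4$. Then $G$ has a $2$-linear coloring in which there is no monochromatic vertex.
   Context: A graph is $2$-degenerate if every subgraph of it has a vertex of degree at most $2$. A linear forest is a forest each of whose components is a path. A $2$-linear coloring of $G$ is a map $c:E(G)\to\{1,2\}$ such that each color class forms a linear forest. Given a $2$-linear coloring of $G$, a vertex is called monochromatic if it has degree exactly $2$ in $G$ and both edges incident with it receive the same color. *)

theory Defs
  imports Main
begin

text \<open>
  Undirected graphs are given by a vertex set and a set of edges, each edge being the
  set of its two distinct end vertices; this rules out loops and parallel edges.
\<close>

definition simple_graph :: "'a set \<Rightarrow> 'a set set \<Rightarrow> bool" where
  "simple_graph V E \<longleftrightarrow> (\<forall>e\<in>E. \<exists>u\<in>V. \<exists>v\<in>V. u \<noteq> v \<and> e = {u, v})"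

definition is_subgraph :: "'a set \<Rightarrow> 'a set set \<Rightarrow> 'a set \<Rightarrow> 'a set set \<Rightarrow> bool" where
  "is_subgraph W F V E \<longleftrightarrow> simple_graph W F \<and> W \<subseteq> V \<and> F \<subseteq> E"

definition vertex_degree :: "'a set set \<Rightarrow> 'a \<Rightarrow> nat" where
  "vertex_degree E v = card {e \<in> E. v \<in> e}"

text \<open>The null graph has no vertex at all, so it is excluded from the subgraphs considered.\<close>

definition degenerate :: "nat \<Rightarrow> 'a set \<Rightarrow> 'a set set \<Rightarrow> bool" where
  "degenerate k V E \<longleftrightarrow>
     (\<forall>W F. is_subgraph W F V E \<and> W \<noteq> {} \<longrightarrow> (\<exists>v\<in>W. vertex_degree F v \<le> k))"

definition bipartite_graph :: "'a set \<Rightarrow> 'a set set \<Rightarrow> bool" where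
  "bipartite_graph V E \<longleftrightarrow>
     (\<exists>A B. A \<union> B = V \<and> A \<inter> B = {} \<and> (\<forall>e\<in>E. \<exists>a\<in>A. \<exists>b\<in>B. e = {a, b}))"

definition is_cycle :: "'a set set \<Rightarrow> 'a list \<Rightarrow> bool" where
  "is_cycle E vs \<longleftrightarrow> 3 \<le> length vs \<and> distinct vs \<and>
     (\<forall>i<length vs. {vs ! i, vs ! (Suc i mod length vs)} \<in> E)"

definition is_forest :: "'a set \<Rightarrow> 'a set set \<Rightarrow> bool" where
  "is_forest V E \<longleftrightarrow> simple_graph V E \<and> (\<nexists>vs. is_cycle E vs)"

text \<open>
  A single vertex without edges counts as a path, so isolated vertices are allowed in a
  linear forest.
\<close>

definition path_graph :: "'a set \<Rightarrow> 'a set set \<Rightarrow> bool" where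
  "path_graph V E \<longleftrightarrow> (\<exists>vs. vs \<noteq> [] \<and> distinct vs \<and> V = set vs \<and>
     E = {{vs ! i, vs ! Suc i} | i. Suc i < length vs})"

definition components :: "'a set \<Rightarrow> 'a set set \<Rightarrow> ('a set \<times> 'a set set) set" where
  "components V E =
     (\<lambda>u. let C = {v \<in> V. (\<lambda>x y. {x, y} \<in> E)\<^sup>*\<^sup>* u v} in (C, {e \<in> E. e \<subseteq> C})) ` V"

definition linear_forest :: "'a set \<Rightarrow> 'a set set \<Rightarrow> bool" where
  "linear_forest V E \<longleftrightarrow> is_forest V E \<and> (\<forall>(C, F) \<in> components V E. path_graph C F)"

text \<open>Only the values of a coloring on the edges of the graph matter.\<close>

definition two_linear_coloring :: "'a set \<Rightarrow> 'a set set \<Rightarrow> ('a set \<Rightarrow> nat) \<Rightarrow> bool" where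
  "two_linear_coloring V E c \<longleftrightarrow> (\<forall>e\<in>E. c e \<in> {1, 2}) \<and>
     (\<forall>i\<in>{1, 2}. linear_forest V {e \<in> E. c e = i})"

definition monochromatic :: "'a set set \<Rightarrow> ('a set \<Rightarrow> nat) \<Rightarrow> 'a \<Rightarrow> bool" where
  "monochromatic E c v \<longleftrightarrow> vertex_degree E v = 2 \<and>
     (\<forall>e\<in>E. \<forall>f\<in>E. v \<in> e \<and> v \<in> f \<longrightarrow> c e = c f)"

end

theory Submission
  imports Defs "HOL-Combinatorics.Transposition"
begin

text \<open>
  By degeneracy one can mark at most two edges at every vertex so that every nonempty vertex set
  \<open>U\<close> has a vertex all of whose edges inside \<open>U\<close> are marked at it. At every vertex pair up the
  incident edges, leaving at most one unpaired, so that two marked edges are paired with each other.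
  An edge lies in at most one pair at each of its two ends, so by bipartiteness the pairs form the
  union of two matchings on the edge set. Such a union is bipartite, hence there is a coloring in
  which paired edges differ. Then no vertex has three edges of one color, a vertex of degree 2 sees
  both colors, and a monochromatic cycle is impossible because at one of its vertices both of its
  edges are marked.
\<close>

section \<open>Two-coloring along two involutions\<close>

text \<open>
  The induction removes an \<open>f\<close>-pair \<open>x\<close>, \<open>y\<close> and joins the \<open>g\<close>-partners of \<open>x\<close> and \<open>y\<close>
  to each other.
\<close>

lemma two_involutions_coloring:
  fixes f g :: "'b \<Rightarrow> 'b"
  assumes "finite {x. f x \<noteq> x}" and "\<And>x. f (f x) = x" and "\<And>x. g (g x) = x"
  shows "\<exists>c :: 'b \<Rightarrow> bool. \<forall>x. (f x \<noteq> x \<longrightarrow> c (f x) \<noteq> c x) \<and> (g x \<noteq> x \<longrightarrow> c (g x) \<noteq> c x)"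
  using assms
proof (induction "card {x. f x \<noteq> x}" arbitrary: f g rule: less_induct)
  case less
  note fin = less.prems(1) and ff = less.prems(2) and gg = less.prems(3)
  show ?case
  proof (cases "\<exists>x. f x \<noteq> x")
    case False
    \<comment> \<open>With \<open>f\<close> trivial only \<open>g\<close> matters: \<open>c\<close>
      singles out one chosen element of each set \<open>{x, g x}\<close>.\<close>
    define c where "c x \<longleftrightarrow> x = (SOME z. z \<in> {x, g x})" for x
    have "c (g x) \<noteq> c x" if "g x \<noteq> x" for x
    proof -
      have "{g x, g (g x)} = {x, g x}" using gg by auto
      moreover have "(SOME z. z \<in> {x, g x}) \<in> {x, g x}" by (rule someI[of _ x]) simp
      ultimately show ?thesis using that unfolding c_def by auto
    qed
    with False show ?thesis by blast
  next
    case True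
    then obtain x y where xy: "f x = y" "x \<noteq> y" by metis
    then have fy: "f y = x" using ff by auto
    \<comment> \<open>\<open>f'\<close> forgets the pair \<open>x\<close>, \<open>y\<close>. The
      induction counts only the points moved by \<open>f\<close>, so \<open>g\<close> may be
      replaced by any other involution.\<close>
    define f' where "f' = f(x := x, y := y)"
    have f'f': "f' (f' z) = z" for z
    proof (cases "z = x \<or> z = y")
      case False
      then have "f z \<noteq> x" "f z \<noteq> y" using ff xy(1) fy by metis+
      then show ?thesis using False ff unfolding f'_def by auto
    qed (auto simp: f'_def)
    have sub: "{z. f' z \<noteq> z} \<subset> {z. f z \<noteq> z}"
    proof
      show "{z. f' z \<noteq> z} \<subseteq> {z. f z \<noteq> z}" unfolding f'_def by auto
      have "x \<notin> {z. f' z \<noteq> z}" "x \<in> {z. f z \<noteq> z}" unfolding f'_def using xy by simp_all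
      then show "{z. f' z \<noteq> z} \<noteq> {z. f z \<noteq> z}" by metis
    qed
    then have fin': "finite {z. f' z \<noteq> z}" and less': "card {z. f' z \<noteq> z} < card {z. f z \<noteq> z}"
      using fin by (auto intro: finite_subset psubset_card_mono)
    show ?thesis
    proof (cases "g x = y")
      case True
      \<comment> \<open>Here \<open>g\<close> also pairs \<open>x\<close> with \<open>y\<close>, so
        a coloring for \<open>f'\<close> and \<open>g\<close> already separates them.\<close>
      from less.hyps[OF less' fin' f'f' gg] obtain c :: "'b \<Rightarrow> bool" where
        "\<forall>z. (f' z \<noteq> z \<longrightarrow> c (f' z) \<noteq> c z) \<and> (g z \<noteq> z \<longrightarrow> c (g z) \<noteq> c z)" ..
      then have c: "\<And>z. f' z \<noteq> z \<Longrightarrow> c (f' z) \<noteq> c z" "\<And>z. g z \<noteq> z \<Longrightarrow> c (g z) \<noteq> c z"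
        by simp_all
      have "c (f z) \<noteq> c z" if "f z \<noteq> z" for z
      proof (cases "z = x \<or> z = y")
        case True
        then show ?thesis using c(2)[of x] \<open>g x = y\<close> xy fy by metis
      next
        case False
        then show ?thesis using c(1)[of z] that unfolding f'_def by auto
      qed
      then show ?thesis using c(2) by blast
    next
      case False
      then have gy: "g y \<noteq> x" using gg by metis
      \<comment> \<open>Besides \<open>x\<close> and \<open>y\<close>, the \<open>g\<close>-partner
        of one of them becomes a fixed point if \<open>g\<close> fixes the other, since there is
        then nothing to join it to.\<close>
      define g' where "g' z = (if z = x \<or> z = y then z
         else if g z = x then (if g y = y then z else g y)
         else if g z = y then (if g x = x then z else g x) else g z)" for z
      have g'g': "g' (g' z) = z" for z unfolding g'_def using gg False gy by (smt (verit))
      from less.hyps[OF less' fin' f'f' g'g'] obtain c :: "'b \<Rightarrow> bool" where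
        "\<forall>z. (f' z \<noteq> z \<longrightarrow> c (f' z) \<noteq> c z) \<and> (g' z \<noteq> z \<longrightarrow> c (g' z) \<noteq> c z)" ..
      then have c: "\<And>z. f' z \<noteq> z \<Longrightarrow> c (f' z) \<noteq> c z" "\<And>z. g' z \<noteq> z \<Longrightarrow> c (g' z) \<noteq> c z"
        by simp_all
      \<comment> \<open>\<open>a\<close> is the new color of \<open>x\<close>, its negation that of
        \<open>y\<close>. If \<open>g\<close> moves \<open>x\<close>, the choice separates
        \<open>x\<close> from \<open>g x\<close>, and \<open>y\<close> is then separated from its
        partner because \<open>g'\<close> made \<open>g x\<close> and \<open>g y\<close> differ in
        color. If \<open>g\<close> fixes \<open>x\<close>, the choice is made for
        \<open>y\<close>.\<close>
      define a where "a = (if g x \<noteq> x then \<not> c (g x) else c (g y))"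
      define d where "d = c(x := a, y := \<not> a)"
      have dgy: "d (g y) \<noteq> d y" if "g y \<noteq> y"
      proof (cases "g x = x")
        case True
        then show ?thesis using that gy unfolding d_def a_def by auto
      next
        case F: False
        have "g' (g x) = g y" unfolding g'_def using F False that gg by auto
        moreover have "g y \<noteq> g x" using gg xy(2) by metis
        ultimately have "c (g y) \<noteq> c (g x)" using c(2)[of "g x"] by auto
        then show ?thesis using that gy F False unfolding d_def a_def by auto
      qed
      have dgx: "d (g x) \<noteq> d x" if "g x \<noteq> x"
        using that False xy unfolding d_def a_def by auto
      have "d (f z) \<noteq> d z" if "f z \<noteq> z" for z
      proof (cases "z = x \<or> z = y")
        case True
        then show ?thesis using xy fy unfolding d_def by auto
      next
        case F: False
        then have "f z \<noteq> x" "f z \<noteq> y" using ff xy fy by metis+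
        then show ?thesis using c(1)[of z] that F unfolding f'_def d_def by auto
      qed
      moreover have "d (g z) \<noteq> d z" if "g z \<noteq> z" for z
      proof -
        consider "z = x" | "z = y" | "g z = x" | "g z = y" | "z \<notin> {x, y}" "g z \<notin> {x, y}" by blast
        then show ?thesis
        proof cases
          case 3
          then have "g x = z" using gg by metis
          then show ?thesis using dgx 3 that by auto
        next
          case 4
          then have "g y = z" using gg by metis
          then show ?thesis using dgy 4 that by auto
        next
          case 5
          then show ?thesis using c(2)[of z] that unfolding g'_def d_def by auto
        qed (use dgx dgy that in auto)
      qed
      ultimately show ?thesis by blast
    qed
  qed
qed

section \<open>Pairing the edges at a vertex\<close>

text \<open>Pairing successive entries of a list of \<open>S\<close> leaves at most one element
  over. Each pair contributes one element to each color, so with at most four elements no color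
  occurs three times. A two-element set that is itself a pair gets both colors. In the application
  \<open>S\<close> holds the edges at a vertex and \<open>B\<close> the marked ones.\<close>

lemma pairing_exists:
  fixes S B :: "'b set"
  assumes "finite S" "card S \<le> 4" "B \<subseteq> S" "card B \<le> 2"
  shows "\<exists>p. (\<forall>z. p (p z) = z) \<and> (\<forall>z\<in>S. p z \<in> S) \<and>
    (\<forall>c :: 'b \<Rightarrow> bool. (\<forall>z\<in>S. p z \<noteq> z \<longrightarrow> c (p z) \<noteq> c z) \<longrightarrow>
       (\<forall>i. card {z\<in>S. c z = i} \<le> 2) \<and>
       (\<forall>i. card S = 2 \<longrightarrow> \<not> (\<forall>z\<in>S. c z = i)) \<and> (\<forall>i. card B = 2 \<longrightarrow> \<not> (\<forall>z\<in>B. c z = i)))"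
proof -
  have finB: "finite B" using assms finite_subset by blast
  obtain bs rs where bs: "set bs = B" "distinct bs" and rs: "set rs = S - B" "distinct rs"
    using finite_distinct_list[OF finB] finite_distinct_list[of "S - B"] assms(1) by auto
  \<comment> \<open>Listing \<open>B\<close> first makes its elements, if there are two, the first
    pair.\<close>
  define xs where "xs = bs @ rs"
  have xs: "set xs = S" "distinct xs" unfolding xs_def using bs rs assms(3) by auto
  have len: "length xs = card S" using xs distinct_card by metis
  have lenb: "length bs = card B" using bs distinct_card by metis
  have B2: "B = {a, b}" if "xs = a # b # ys" "card B = 2" for a b ys
  proof -
    from that lenb have "length bs = 2" by simp
    then obtain u v where "bs = [u, v]"
      by (metis (no_types, lifting) One_nat_def Suc_1 length_0_conv length_Suc_conv)
    then show ?thesis using that bs unfolding xs_def by auto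
  qed
  have two: "(\<forall>i. card S = 2 \<longrightarrow> \<not> (\<forall>z\<in>S. c z = i)) \<and> (\<forall>i. card B = 2 \<longrightarrow> \<not> (\<forall>z\<in>B. c z = i))"
    if "xs = a # b # ys" "c a \<noteq> c b" for a b ys and c :: "'b \<Rightarrow> bool"
  proof -
    have "a \<in> S" "b \<in> S" using xs that(1) by auto
    then show ?thesis using B2[OF that(1)] that(2) by auto
  qed
  \<comment> \<open>From two elements on, the first pair settles the claims about \<open>S\<close>
    and \<open>B\<close>; only the bound on the color classes depends on the length of the
    list.\<close>
  have pairing: ?thesis
    if "xs = a # b # ys" "\<And>z. p (p z) = z" "\<And>z. z \<in> S \<Longrightarrow> p z \<in> S" "p a = b"
      and le: "\<And>(c :: 'b \<Rightarrow> bool) i. c a \<noteq> c b \<Longrightarrow> \<forall>z\<in>S. p z \<noteq> z \<longrightarrow> c (p z) \<noteq> c z \<Longrightarrow>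
        card {z \<in> S. c z = i} \<le> 2" for a b ys p
  proof -
    have "(\<forall>i. card {z \<in> S. c z = i} \<le> 2) \<and>
      (\<forall>i. card S = 2 \<longrightarrow> \<not> (\<forall>z\<in>S. c z = i)) \<and> (\<forall>i. card B = 2 \<longrightarrow> \<not> (\<forall>z\<in>B. c z = i))"
      if h: "\<forall>z\<in>S. p z \<noteq> z \<longrightarrow> c (p z) \<noteq> c z" for c :: "'b \<Rightarrow> bool"
    proof -
      have "a \<in> S" "b \<noteq> a" using xs \<open>xs = a # b # ys\<close> by auto
      with h \<open>p a = b\<close> have ab: "c a \<noteq> c b" by auto
      show ?thesis using two[OF \<open>xs = a # b # ys\<close> ab] le[OF ab h] by auto
    qed
    then show ?thesis using that(2,3) by (intro exI[of _ p] conjI) simp_all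
  qed
  \<comment> \<open>With fewer than two elements the identity works, as neither \<open>S\<close> nor
    \<open>B\<close> has size 2.\<close>
  have le1: "card B \<noteq> 2" if "card S < 2" using that card_mono[OF assms(1,3)] by simp
  consider "xs = []" | a where "xs = [a]" | a b where "xs = [a, b]"
    | a b d where "xs = [a, b, d]" | a b d e where "xs = [a, b, d, e]"
  proof -
    have "length xs \<le> 4" using len assms by simp
    then show ?thesis using that
      by (cases xs; cases "tl xs"; cases "tl (tl xs)"; cases "tl (tl (tl xs))"; cases "tl (tl (tl (tl xs)))") auto
  qed
  then show ?thesis
  proof cases
    case 1
    then have "S = {}" using xs by simp
    then show ?thesis using le1 by (intro exI[of _ id]) auto
  next
    case (2 a)
    then have S: "S = {a}" using xs by simp
    have "card {z \<in> S. P z} \<le> 2" for P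
      using card_mono[of S "{z \<in> S. P z}"] S by fastforce
    then show ?thesis using le1 S by (intro exI[of _ id]) auto
  next
    case (3 a b)
    then have S: "S = {a, b}" "a \<noteq> b" using xs by auto
    have le: "card {z \<in> S. c z = i} \<le> 2" for c :: "'b \<Rightarrow> bool" and i
      using card_mono[of S "{z \<in> S. c z = i}"] S by fastforce
    show ?thesis
    proof (rule pairing[OF 3, of "transpose a b"])
      show "card {z \<in> S. c z = i} \<le> 2"
        if "c a \<noteq> c b" "\<forall>z\<in>S. transpose a b z \<noteq> z \<longrightarrow> c (transpose a b z) \<noteq> c z"
        for c :: "'b \<Rightarrow> bool" and i
        by (rule le)
    qed (use S in \<open>auto simp: transpose_def\<close>)
  next
    case (4 a b d)
    then have S: "S = {a, b, d}" "a \<noteq> b" "a \<noteq> d" "b \<noteq> d" using xs by auto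
    have le: "card {z \<in> S. c z = i} \<le> 2" if "c a \<noteq> c b" for c :: "'b \<Rightarrow> bool" and i
    proof -
      \<comment> \<open>Exactly one of \<open>a\<close>, \<open>b\<close> has color
        \<open>i\<close>; the unpaired \<open>d\<close> adds at most one more.\<close>
      have "{z \<in> S. c z = i} \<subseteq> (if c a = i then {a, d} else {b, d})"
        using S that by auto
      then show ?thesis
        by (rule order_trans[OF card_mono, rotated]) (auto simp: card_insert_if)
    qed
    show ?thesis
    proof (rule pairing[OF 4, of "transpose a b"])
      show "card {z \<in> S. c z = i} \<le> 2"
        if "c a \<noteq> c b" "\<forall>z\<in>S. transpose a b z \<noteq> z \<longrightarrow> c (transpose a b z) \<noteq> c z"
        for c :: "'b \<Rightarrow> bool" and i
        using that(1) by (rule le)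
    qed (use S in \<open>auto simp: transpose_def\<close>)
  next
    case (5 a b d e)
    then have S: "S = {a, b, d, e}" "a \<noteq> b" "a \<noteq> d" "b \<noteq> d" "a \<noteq> e" "b \<noteq> e" "d \<noteq> e"
      using xs by auto
    have le: "card {z \<in> S. c z = i} \<le> 2" if "c a \<noteq> c b" "c d \<noteq> c e" for c :: "'b \<Rightarrow> bool" and i
    proof -
      \<comment> \<open>Each of the two pairs supplies exactly one element of color
        \<open>i\<close>.\<close>
      have "{z \<in> S. c z = i} \<subseteq> {if c a = i then a else b, if c d = i then d else e}"
        using S that by auto
      then show ?thesis
        by (rule order_trans[OF card_mono, rotated]) (auto simp: card_insert_if)
    qed
    show ?thesis
    proof (rule pairing[OF 5, of "transpose a b \<circ> transpose d e"])
      show "card {z \<in> S. c z = i} \<le> 2"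
        if "c a \<noteq> c b" "\<forall>z\<in>S. (transpose a b \<circ> transpose d e) z \<noteq> z \<longrightarrow> c ((transpose a b \<circ> transpose d e) z) \<noteq> c z"
        for c :: "'b \<Rightarrow> bool" and i
        using that(1) bspec[OF that(2), of d] S by (intro le) (auto simp: transpose_def)
    qed (use S in \<open>auto simp: transpose_def\<close>)
  qed
qed

section \<open>Marked edges from degeneracy\<close>

text \<open>This is a degeneracy order in disguise: vertices of \<open>W\<close> are removed one by
  one, each of degree at most \<open>k\<close> in what is left, and \<open>B v\<close> holds the
  edges from \<open>v\<close> to the vertices still present. The first vertex of \<open>U\<close> to
  be removed has all its edges inside \<open>U\<close> marked.\<close>

lemma degenerate_back_edges:
  assumes "finite W" "W \<subseteq> V" "simple_graph V E" "degenerate k V E"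
  shows "\<exists>B. (\<forall>v. B v \<subseteq> {e \<in> E. v \<in> e} \<and> card (B v) \<le> k) \<and>
    (\<forall>U \<subseteq> W. U \<noteq> {} \<longrightarrow> (\<exists>v\<in>U. {e \<in> E. v \<in> e \<and> e \<subseteq> U} \<subseteq> B v))"
  using assms(1,2)
proof (induction "card W" arbitrary: W)
  case 0
  then show ?case by (intro exI[of _ "\<lambda>_. {}"]) auto
next
  case (Suc n)
  \<comment> \<open>Degeneracy is applied to the subgraph induced by \<open>W\<close>.\<close>
  define F where "F = {e \<in> E. e \<subseteq> W}"
  have "is_subgraph W F V E"
    using assms(3) Suc.prems unfolding is_subgraph_def simple_graph_def F_def by fastforce
  moreover have "W \<noteq> {}" using Suc.hyps by auto
  ultimately obtain v where v: "v \<in> W" "vertex_degree F v \<le> k"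
    using assms(4) unfolding degenerate_def by blast
  have "n = card (W - {v})" "finite (W - {v})" "W - {v} \<subseteq> V" using Suc v by auto
  from Suc.hyps(1)[OF this] obtain B where B: "\<And>u. B u \<subseteq> {e \<in> E. u \<in> e} \<and> card (B u) \<le> k"
    "\<And>U. U \<subseteq> W - {v} \<Longrightarrow> U \<noteq> {} \<Longrightarrow> \<exists>u\<in>U. {e \<in> E. u \<in> e \<and> e \<subseteq> U} \<subseteq> B u"
    by blast
  define B' where "B' = B(v := {e \<in> F. v \<in> e})"
  have "\<forall>u. B' u \<subseteq> {e \<in> E. u \<in> e} \<and> card (B' u) \<le> k"
    using B(1) v(2) unfolding B'_def vertex_degree_def F_def by auto
  moreover have "\<exists>u\<in>U. {e \<in> E. u \<in> e \<and> e \<subseteq> U} \<subseteq> B' u" if U: "U \<subseteq> W" "U \<noteq> {}" for U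
  proof (cases "v \<in> U")
    case True
    then show ?thesis using that unfolding B'_def F_def by (intro bexI[of _ v]) auto
  next
    case False
    then have "U \<subseteq> W - {v}" using U by auto
    from B(2)[OF this U(2)]
    obtain u where "u \<in> U" "{e \<in> E. u \<in> e \<and> e \<subseteq> U} \<subseteq> B u" ..
    then show ?thesis using False unfolding B'_def by (intro bexI[of _ u]) auto
  qed
  ultimately show ?case by blast
qed

section \<open>Linear forests and cycles\<close>

text \<open>A longest path through \<open>u\<close> is the whole component of \<open>u\<close>:
  maximality and the degree bound prevent edges leaving it, and acyclicity excludes chords.\<close>

lemma linear_forestI:
  assumes "finite V" "is_forest V F" "\<And>v. v \<in> V \<Longrightarrow> vertex_degree F v \<le> 2"
  shows "linear_forest V F"
proof -
  have simple: "simple_graph V F" and acyc: "\<And>vs. \<not> is_cycle F vs"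
    using assms(2) unfolding is_forest_def by auto
  have FV: "x \<in> V \<and> y \<in> V \<and> x \<noteq> y" if "{x, y} \<in> F" for x y
    using simple that unfolding simple_graph_def by (fastforce simp: doubleton_eq_iff)
  have "F \<subseteq> Pow V" using simple unfolding simple_graph_def by auto
  then have finF: "finite F" using assms(1) finite_subset by blast
  have "path_graph C {e \<in> F. e \<subseteq> C}"
    if u: "u \<in> V" and C: "C = {v \<in> V. (\<lambda>x y. {x, y} \<in> F)\<^sup>*\<^sup>* u v}" for u C
  proof -
    \<comment> \<open>\<open>P\<close> describes the paths through \<open>u\<close>; they have at
      most \<open>card V\<close> vertices, so a longest one exists.\<close>
    define P where "P vs \<longleftrightarrow> distinct vs \<and> u \<in> set vs \<and> set vs \<subseteq> V \<and>
      successively (\<lambda>x y. {x, y} \<in> F) vs" for vs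
    have "P [u]" using u unfolding P_def by simp
    moreover have "\<forall>vs. P vs \<longrightarrow> length vs < Suc (card V)"
      using assms(1) unfolding P_def by (metis card_mono distinct_card less_Suc_eq_le)
    ultimately obtain vs where vs: "P vs" and max: "\<And>ws. P ws \<Longrightarrow> length ws \<le> length vs"
      using ex_has_greatest_nat[of P "[u]" length "Suc (card V)"] by blast
    have ne: "vs \<noteq> []" using vs unfolding P_def by auto
    have dist: "distinct vs" using vs unfolding P_def by simp
    have edge: "{vs ! i, vs ! Suc i} \<in> F" if "Suc i < length vs" for i
      using vs that unfolding P_def successively_conv_nth by blast
    have closed: "y \<in> set vs" if x: "x \<in> set vs" and xy: "{x, y} \<in> F" for x y
    proof (rule ccontr)
      assume y: "y \<notin> set vs"
      obtain i where i: "i < length vs" "x = vs ! i" using x by (metis in_set_conv_nth)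
      have yV: "y \<in> V" using FV xy by blast
      \<comment> \<open>At either end of the path, \<open>y\<close> would extend it; at an inner
        vertex, the edge to \<open>y\<close> would be a third one.\<close>
      consider "i = 0" | "Suc i = length vs" | j where "i = Suc j" "Suc i < length vs"
        using i by (cases i; force)
      then show False
      proof cases
        case 1
        then have "P (y # vs)" using vs y yV i xy ne unfolding P_def
          by (auto simp: successively_Cons hd_conv_nth insert_commute)
        then show False using max by fastforce
      next
        case 2
        then have "x = last vs" using i ne by (metis diff_Suc_1 last_conv_nth)
        then have "P (vs @ [y])" using vs y yV xy ne unfolding P_def
          by (auto simp: successively_append_iff)
        then show False using max by fastforce
      next
        case 3
        define a b where "a = vs ! j" and "b = vs ! Suc i"
        have ab: "a \<in> set vs" "b \<in> set vs" "a \<noteq> b"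
          using 3 dist unfolding a_def b_def by (auto simp: nth_eq_iff_index_eq)
        have "{a, x} \<in> F" "{x, b} \<in> F" using edge[of j] edge[of i] 3 i unfolding a_def b_def by auto
        then have "{{a, x}, {x, b}, {x, y}} \<subseteq> {e \<in> F. x \<in> e}" using xy by auto
        then have "card {{a, x}, {x, b}, {x, y}} \<le> vertex_degree F x"
          unfolding vertex_degree_def using finF by (intro card_mono) auto
        moreover have "card {{a, x}, {x, b}, {x, y}} = 3"
          using ab y by (auto simp: card_insert_if doubleton_eq_iff)
        ultimately show False using assms(3)[of x] FV xy by fastforce
      qed
    qed
    have "set vs = C"
    proof
      have "x \<in> set vs" if "(\<lambda>x y. {x, y} \<in> F)\<^sup>*\<^sup>* u x" for x
        using that by induction (use vs closed in \<open>auto simp: P_def\<close>)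
      then show "C \<subseteq> set vs" using C by auto
      \<comment> \<open>Both directions are used because \<open>u\<close> may lie anywhere on the
        path.\<close>
      have adj: "(\<lambda>x y. {x, y} \<in> F)\<^sup>*\<^sup>* (vs ! i) (vs ! j) \<and> (\<lambda>x y. {x, y} \<in> F)\<^sup>*\<^sup>* (vs ! j) (vs ! i)"
        if "i \<le> j" "j < length vs" for i j
        using that
      proof (induction j rule: dec_induct)
        case (step n)
        then have "{vs ! n, vs ! Suc n} \<in> F" "{vs ! Suc n, vs ! n} \<in> F"
          using edge[of n] by (auto simp: insert_commute)
        with step show ?case
          by (auto intro: rtranclp.rtrancl_into_rtrancl converse_rtranclp_into_rtranclp)
      qed simp
      obtain k where "k < length vs" "u = vs ! k" using vs unfolding P_def by (metis in_set_conv_nth)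
      then have "(\<lambda>x y. {x, y} \<in> F)\<^sup>*\<^sup>* u (vs ! i)" if "i < length vs" for i
        using adj[of i k] adj[of k i] that by (cases "i \<le> k") auto
      then show "set vs \<subseteq> C" using vs C unfolding P_def by (auto simp: in_set_conv_nth)
    qed
    \<comment> \<open>Otherwise the segment from \<open>i\<close> to \<open>j\<close> would be
      closed by the chord to a cycle; it has at least three vertices because \<open>j\<close> is not
      \<open>Suc i\<close>.\<close>
    have consec: "j = Suc i" if ij: "i < j" "j < length vs" "{vs ! i, vs ! j} \<in> F" for i j
    proof (rule ccontr)
      assume "j \<noteq> Suc i"
      define ws where "ws = take (Suc j - i) (drop i vs)"
      have len: "length ws = Suc j - i" using ij unfolding ws_def by simp
      have nth: "ws ! m = vs ! (i + m)" if "m \<le> j - i" for m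
        using that ij unfolding ws_def by simp
      have "{ws ! m, ws ! (Suc m mod length ws)} \<in> F" if m: "m < length ws" for m
      proof (cases "Suc m = length ws")
        case True
        then have "m = j - i" using len ij by simp
        then show ?thesis using True nth[of m] nth[of 0] ij by (simp add: insert_commute)
      next
        case False
        then have "Suc m < length ws" using m by simp
        then show ?thesis using nth[of m] nth[of "Suc m"] edge[of "i + m"] len ij by simp
      qed
      moreover have "3 \<le> length ws" using len ij \<open>j \<noteq> Suc i\<close> by simp
      ultimately have "is_cycle F ws" using dist unfolding is_cycle_def ws_def by simp
      then show False using acyc by blast
    qed
    have "{e \<in> F. e \<subseteq> C} = {{vs ! i, vs ! Suc i} | i. Suc i < length vs}"
    proof
      show "{{vs ! i, vs ! Suc i} | i. Suc i < length vs} \<subseteq> {e \<in> F. e \<subseteq> C}"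
        using edge \<open>set vs = C\<close> by (auto intro: nth_mem)
      show "{e \<in> F. e \<subseteq> C} \<subseteq> {{vs ! i, vs ! Suc i} | i. Suc i < length vs}"
      proof
        fix e assume "e \<in> {e \<in> F. e \<subseteq> C}"
        then have e: "e \<in> F" "e \<subseteq> set vs" using \<open>set vs = C\<close> by auto
        then obtain x y where xy: "e = {x, y}" "x \<noteq> y" using simple unfolding simple_graph_def by blast
        then obtain i j where ij: "i < length vs" "j < length vs" "x = vs ! i" "y = vs ! j"
          using e by (metis in_set_conv_nth insert_subset)
        then consider "i < j" | "j < i" using xy by (metis nat_neq_iff)
        then show "e \<in> {{vs ! i, vs ! Suc i} | i. Suc i < length vs}"
        proof cases
          case 1
          then have "j = Suc i" using consec[of i j] ij e xy by simp
          then show ?thesis using ij xy by blast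
        next
          case 2
          then have "i = Suc j" using consec[of j i] ij e xy by (simp add: insert_commute)
          then show ?thesis using ij xy by (auto simp: insert_commute)
        qed
      qed
    qed
    then show ?thesis unfolding path_graph_def using ne dist \<open>set vs = C\<close> by blast
  qed
  then show ?thesis using assms(2) unfolding linear_forest_def components_def by (auto simp: Let_def)
qed

text \<open>The edges lead to the cyclic predecessor and successor of \<open>v\<close>, which are
  different because the cycle has at least three vertices.\<close>

lemma cycle_edges_at:
  assumes "is_cycle F vs" "v \<in> set vs"
  shows "\<exists>e f. e \<noteq> f \<and> {e, f} \<subseteq> {e \<in> F. v \<in> e \<and> e \<subseteq> set vs}"
proof -
  have len: "3 \<le> length vs" and dist: "distinct vs"
    and edge: "\<And>i. i < length vs \<Longrightarrow> {vs ! i, vs ! (Suc i mod length vs)} \<in> F"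
    using assms(1) unfolding is_cycle_def by auto
  define n where "n = length vs"
  obtain i where i: "i < n" "v = vs ! i" using assms(2) unfolding n_def by (metis in_set_conv_nth)
  define j k where "j = (if i = 0 then n - 1 else i - 1)" and "k = (if Suc i = n then 0 else Suc i)"
  have n3: "3 \<le> n" using len n_def by simp
  have j: "j < n" "Suc j mod n = i" and k: "k < n" "Suc i mod n = k" and "j \<noteq> k" "j \<noteq> i" "k \<noteq> i"
    using i n3 unfolding j_def k_def by (auto split: if_splits)
  have "{vs ! j, v} \<in> F" "{v, vs ! k} \<in> F"
    using edge[of j] edge[of i] i j k unfolding n_def by auto
  moreover have "{vs ! j, v} \<noteq> {v, vs ! k}"
    using \<open>j \<noteq> k\<close> \<open>j \<noteq> i\<close> i j k dist unfolding n_def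
    by (auto simp: doubleton_eq_iff nth_eq_iff_index_eq)
  moreover have "{vs ! j, v} \<subseteq> set vs" "{v, vs ! k} \<subseteq> set vs"
    using i j k unfolding n_def by auto
  ultimately show ?thesis by (intro exI[of _ "{vs ! j, v}"] exI[of _ "{v, vs ! k}"]) auto
qed

section \<open>Construction of the coloring\<close>

theorem theorem4:
  fixes V :: "'a set" and E :: "'a set set"
  assumes "finite V" and "simple_graph V E"
    and "bipartite_graph V E"
    and "degenerate 2 V E"
    and "\<forall>v\<in>V. vertex_degree E v \<le> 4"
  shows "\<exists>c. two_linear_coloring V E c \<and> \<not> (\<exists>v\<in>V. monochromatic E c v)"
proof -
  have "E \<subseteq> Pow V" using assms(2) unfolding simple_graph_def by auto
  then have finE: "finite E" using assms(1) finite_subset by blast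
  obtain X Y where XY: "X \<union> Y = V" "X \<inter> Y = {}" "\<And>e. e \<in> E \<Longrightarrow> \<exists>a\<in>X. \<exists>b\<in>Y. e = {a, b}"
    using assms(3) unfolding bipartite_graph_def by auto
  obtain B where B: "\<And>v. B v \<subseteq> {e \<in> E. v \<in> e}" "\<And>v. card (B v) \<le> 2"
    "\<And>U. U \<subseteq> V \<Longrightarrow> U \<noteq> {} \<Longrightarrow> \<exists>v\<in>U. {e \<in> E. v \<in> e \<and> e \<subseteq> U} \<subseteq> B v"
    using degenerate_back_edges[OF assms(1) subset_refl assms(2,4)] by blast
  define S where "S v = {e \<in> E. v \<in> e}" for v
  \<comment> \<open>The clauses serve, in this order, the degree bound within a color, the absence
    of monochromatic vertices and the absence of monochromatic cycles.\<close>
  define good where "good v c \<longleftrightarrow> (\<forall>i. card {z \<in> S v. c z = i} \<le> 2) \<and>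
       (\<forall>i. card (S v) = 2 \<longrightarrow> \<not> (\<forall>z\<in>S v. c z = i)) \<and>
       (\<forall>i. card (B v) = 2 \<longrightarrow> \<not> (\<forall>z\<in>B v. c z = i))"
    for v and c :: "'a set \<Rightarrow> bool"
  have "\<forall>v\<in>V. \<exists>p. (\<forall>z. p (p z) = z) \<and> (\<forall>z\<in>S v. p z \<in> S v) \<and>
    (\<forall>c. (\<forall>z\<in>S v. p z \<noteq> z \<longrightarrow> c (p z) \<noteq> c z) \<longrightarrow> good v c)"
  proof
    fix v assume "v \<in> V"
    then have "finite (S v)" "card (S v) \<le> 4" "B v \<subseteq> S v" "card (B v) \<le> 2"
      using finE assms(5) B unfolding S_def vertex_degree_def by auto
    from pairing_exists[OF this]
    show "\<exists>p. (\<forall>z. p (p z) = z) \<and> (\<forall>z\<in>S v. p z \<in> S v) \<and>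
      (\<forall>c. (\<forall>z\<in>S v. p z \<noteq> z \<longrightarrow> c (p z) \<noteq> c z) \<longrightarrow> good v c)"
      unfolding good_def .
  qed
  then obtain p where p: "\<And>v z. v \<in> V \<Longrightarrow> p v (p v z) = z"
    "\<And>v z. v \<in> V \<Longrightarrow> z \<in> S v \<Longrightarrow> p v z \<in> S v"
    "\<And>v c. v \<in> V \<Longrightarrow> (\<And>z. z \<in> S v \<Longrightarrow> p v z \<noteq> z \<Longrightarrow> c (p v z) \<noteq> c z) \<Longrightarrow> good v c"
    by metis
  \<comment> \<open>Every edge has exactly one end in the side \<open>Z\<close>, so the pairings at
    the vertices of \<open>Z\<close> combine into one involution. The identity outside
    \<open>E\<close> keeps the set of moved points finite.\<close>
  define q where "q Z e = (if e \<in> E then p (THE v. v \<in> Z \<and> v \<in> e) e else e)" for Z e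
  have q: "q Z e = p v e" if v: "Z = X \<or> Z = Y" "v \<in> Z" "e \<in> S v" for Z v e
  proof -
    obtain a b where "a \<in> X" "b \<in> Y" "e = {a, b}" "e \<in> E" using XY(3) v unfolding S_def by blast
    then have "(THE w. w \<in> Z \<and> w \<in> e) = v"
      using that XY(2) unfolding S_def by (intro the_equality) auto
    then show ?thesis using \<open>e \<in> E\<close> unfolding q_def by simp
  qed
  have q_inv: "q Z (q Z e) = e" if Z: "Z = X \<or> Z = Y" for Z e
  proof (cases "e \<in> E")
    case True
    then obtain v where v: "v \<in> Z" "e \<in> S v" using XY(3)[OF True] Z unfolding S_def by auto
    then have "v \<in> V" using XY(1) Z by auto
    then show ?thesis using q[OF Z v(1)] v p by metis
  qed (simp add: q_def)
  have "{e. q X e \<noteq> e} \<subseteq> E" unfolding q_def by auto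
  then have fin: "finite {e. q X e \<noteq> e}" using finE finite_subset by blast
  obtain c where c: "\<And>e. q X e \<noteq> e \<Longrightarrow> c (q X e) \<noteq> c e" "\<And>e. q Y e \<noteq> e \<Longrightarrow> (c (q Y e) :: bool) \<noteq> c e"
    using two_involutions_coloring[OF fin q_inv[of X] q_inv[of Y]] by auto
  \<comment> \<open>On the edges at \<open>v\<close>, either \<open>q X\<close> or
    \<open>q Y\<close> is the local pairing \<open>p v\<close>, so \<open>c\<close> respects that
    pairing.\<close>
  have good: "good v c" if "v \<in> V" for v
    using that XY(1) c q by (intro p(3)) (metis Un_iff)+
  define d :: "'a set \<Rightarrow> nat" where "d e = (if c e then 1 else 2)" for e
  \<comment> \<open>Color 1 stands for true and color 2 for false, so color \<open>i\<close> has the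
    truth value of \<open>i = 1\<close>.\<close>
  have dc: "(d e = i) = (c e = (i = 1))" if "i \<in> {1, 2}" for e i
    using that unfolding d_def by auto
  have "linear_forest V {e \<in> E. d e = i}" if i: "i \<in> {1, 2}" for i
  proof (rule linear_forestI[OF assms(1)])
    fix v assume "v \<in> V"
    have "{e \<in> {e \<in> E. d e = i}. v \<in> e} = {e \<in> S v. c e = (i = 1)}"
      using dc[OF i] unfolding S_def by auto
    then show "vertex_degree {e \<in> E. d e = i} v \<le> 2"
      using good[OF \<open>v \<in> V\<close>] unfolding good_def vertex_degree_def by simp
  next
    have "\<not> is_cycle {e \<in> E. d e = i} vs" for vs
    proof
      assume cyc: "is_cycle {e \<in> E. d e = i} vs"
      have "set vs \<subseteq> V"
        using cycle_edges_at[OF cyc] \<open>E \<subseteq> Pow V\<close> by fastforce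
      moreover have "set vs \<noteq> {}" using cyc unfolding is_cycle_def by auto
      \<comment> \<open>Applied to the vertex set of the cycle, the marking yields a vertex at which
        both cycle edges are marked.\<close>
      ultimately obtain v where v: "v \<in> set vs" "{e \<in> E. v \<in> e \<and> e \<subseteq> set vs} \<subseteq> B v" "v \<in> V"
        using B(3)[of "set vs"] by blast
      obtain e f where ef: "e \<noteq> f" "{e, f} \<subseteq> {e \<in> {e \<in> E. d e = i}. v \<in> e \<and> e \<subseteq> set vs}"
        using cycle_edges_at[OF cyc v(1)] by (elim exE conjE)
      then have sub: "{e, f} \<subseteq> B v" using v(2) by auto
      have "finite (B v)" using B(1) finE finite_subset[of "B v" E] by auto
      \<comment> \<open>Two distinct marked edges exhaust \<open>B v\<close>, which by the choice of
        the pairing carries both colors once it has size 2.\<close>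
      then have eq: "{e, f} = B v" using card_seteq[OF _ sub] B(2)[of v] ef(1) by simp
      then have "card (B v) = 2" using ef(1) by (metis card_2_iff)
      moreover have "\<forall>z\<in>B v. c z = (i = 1)" using ef(2) dc[OF i] unfolding eq[symmetric] by auto
      ultimately show False using good[OF v(3)] unfolding good_def by blast
    qed
    then show "is_forest V {e \<in> E. d e = i}"
      using assms(2) unfolding is_forest_def simple_graph_def by auto
  qed
  then have "two_linear_coloring V E d" unfolding two_linear_coloring_def by (auto simp: d_def)
  moreover have "\<not> monochromatic E d v" if "v \<in> V" for v
  proof
    assume m: "monochromatic E d v"
    then have "card (S v) = 2" unfolding monochromatic_def vertex_degree_def S_def by simp
    moreover from this obtain e where "e \<in> S v" by fastforce
    moreover have "c z = c e" if "z \<in> S v" "e \<in> S v" for z e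
    proof -
      have "d z = d e" using m that unfolding monochromatic_def S_def by blast
      then show ?thesis unfolding d_def by (auto split: if_splits)
    qed
    ultimately show False using good[OF \<open>v \<in> V\<close>] unfolding good_def by metis
  qed
  ultimately show ?thesis by blast
qed

end
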